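(* For all $p', p'' \in [0,1]$ satisfying $|p'-\frac12| > |p''-\frac12|$, we have $(|S_n^{p''}|)_{n\geq 0} \preceq_{st} (|S_n^{p'}|)_{n\geq 0}$.
   Context: For $p\in[0,1]$, $(S_n^p)_{n\ge 0}$ is the Bernoulli random walk $S_0^p=0$, $S_n^p=X_1^p+\cdots+X_n^p$ ($n\ge 1$), where $X_1^p,X_2^p,\dots$ are i.i.d. with $P(X_n^p=1)=p$ and $P(X_n^p=-1)=1-p$. Stochastic order: for infinite-dimensional random vectors $\mathbf U=(U_n)_{n\ge0}$ and $\mathbf V=(V_n)_{n\ge0}$ (random elements of $\mathbb R^\infty$ with the product topology and its Borel $\sigma$-field), $\mathbf U\preceq_{st}\mathbf V$ means $E f(\mathbf U)\le E f(\mathbf V)$ for all bounded increasing measurable $f:\mathbb R^\infty\to\mathbb R$, where $f$ is increasing if $f(x_0,x_1,\dots)\le f(y_0,y_1,\dots)$ whenever $x_i\le y_i$ for all $i$. The random vectors need not be defined on the same probability space. *)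

theory Defs
  imports "HOL-Probability.Probability"
begin

text \<open>
  The steps are indexed from 1; the value of \<open>X 0\<close> is irrelevant. The distribution of each step
  is determined by the two point masses, which add up to 1, so the steps are i.i.d.
\<close>

locale bernoulli_steps = prob_space M
  for M :: "'a measure" and p :: real and X :: "nat \<Rightarrow> 'a \<Rightarrow> real" +
  assumes p_in_unit: "p \<in> {0..1}"
    and indep_steps: "indep_vars (\<lambda>_. borel) X {1..}"
    and prob_up: "\<And>n. n \<ge> 1 \<Longrightarrow> prob {\<omega> \<in> space M. X n \<omega> = 1} = p"
    and prob_down: "\<And>n. n \<ge> 1 \<Longrightarrow> prob {\<omega> \<in> space M. X n \<omega> = - 1} = 1 - p"

definition walk :: "(nat \<Rightarrow> 'a \<Rightarrow> real) \<Rightarrow> nat \<Rightarrow> 'a \<Rightarrow> real"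
  where "walk X n \<omega> = (\<Sum>i=1..n. X i \<omega>)"

text \<open>
  On \<open>nat \<Rightarrow> real\<close>, \<open>borel\<close> is the Borel \<open>\<sigma>\<close>-field of the product topology and \<open>mono\<close> refers to the
  pointwise order. The relation includes the requirement that \<open>U\<close> and \<open>V\<close> are random vectors, so
  that the expectations below are those of genuine bounded random variables. The two probability
  spaces may differ.
\<close>

definition stoch_le ::
    "'a measure \<Rightarrow> ('a \<Rightarrow> nat \<Rightarrow> real) \<Rightarrow> 'b measure \<Rightarrow> ('b \<Rightarrow> nat \<Rightarrow> real) \<Rightarrow> bool"
  where "stoch_le M U N V \<longleftrightarrow>
    prob_space M \<and> prob_space N \<and> U \<in> borel_measurable M \<and> V \<in> borel_measurable N \<and>
    (\<forall>f :: (nat \<Rightarrow> real) \<Rightarrow> real.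
      f \<in> borel_measurable borel \<longrightarrow> bounded (range f) \<longrightarrow> mono f \<longrightarrow>
      (\<integral>\<omega>. f (U \<omega>) \<partial>M) \<le> (\<integral>\<omega>. f (V \<omega>) \<partial>N))"

end

theory Submission
  imports Defs
begin

text \<open>
  Although the increments of \<open>\<bar>S\<^sub>n\<bar>\<close> depend on the hidden sign of \<open>S\<^sub>n\<close>, this process is a
  Markov chain on the natural numbers. Put \<open>q = 1 - p\<close>. Each signed path from \<open>0\<close> to \<open>k\<close> in \<open>n\<close>
  steps has probability \<open>p\<^sup>u q\<^sup>d\<close> with \<open>u - d = k\<close> and \<open>u + d = n\<close>; reflecting it exchanges \<open>u\<close> and
  \<open>d\<close> and leaves the absolute values unchanged. Hence, given the whole history
  \<open>\<bar>S\<^sub>0\<bar>, \<dots>, \<bar>S\<^sub>n\<bar>\<close> with \<open>\<bar>S\<^sub>n\<bar> = k > 0\<close>, the values \<open>k\<close> and \<open>-k\<close> of \<open>S\<^sub>n\<close> have probabilities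
  proportional to \<open>p\<^sup>k\<close> and \<open>q\<^sup>k\<close>, whatever the history is. The chain therefore moves up from
  \<open>k > 0\<close> with probability \<open>(p \<cdot> p\<^sup>k + q \<cdot> q\<^sup>k) / (p\<^sup>k + q\<^sup>k)\<close>, and from \<open>0\<close> with probability 1
  (lemmas \<open>joint_prob_eq_weight\<close> and \<open>prefix_prob_abs_walk\<close>).

  This probability increases with \<open>\<bar>p - 1/2\<bar>\<close> (lemma \<open>up_prob_mono_dist\<close>). Run the chains for two
  parameters with the same uniform random numbers, each moving up when the current number is at
  most its upward probability. The two states always have the same parity, so they are either
  equal, and then the comparison of the upward probabilities keeps them ordered, or at distance
  at least 2, and then a single step cannot reverse their order (lemma \<open>run_abs_step_mono\<close>).
  The coupled chains have the laws of the two absolute walks, because their finite prefixes do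
  (lemma \<open>distr_abs_walk\<close>), so the pointwise order between them gives the inequality of
  expectations for every increasing function.
\<close>

section \<open>Recursions driven by independent inputs\<close>

text \<open>
  The signed walk and the coupled chain are both of the following form: a deterministic recursion
  fed with an independent sequence. The inputs are indexed from 1, as the steps of the walk are.
\<close>

primrec run :: "('s \<Rightarrow> real \<Rightarrow> 's) \<Rightarrow> 's \<Rightarrow> (nat \<Rightarrow> real) \<Rightarrow> nat \<Rightarrow> 's" where
  "run g s x 0 = s"
| "run g s x (Suc n) = g (run g s x n) (x (Suc n))"

lemma run_cong: "(\<And>i. 1 \<le> i \<Longrightarrow> i \<le> n \<Longrightarrow> x i = y i) \<Longrightarrow> run g s x n = run g s y n"
  by (induction n) auto

lemma all_le_Suc_eq: "(\<forall>i\<le>Suc n. P i) \<longleftrightarrow> (\<forall>i\<le>n. P i) \<and> P (Suc n)"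
  by (auto simp: le_Suc_eq)

lemma measurable_run:
  fixes g :: "'s :: countable \<Rightarrow> real \<Rightarrow> 's"
  assumes g: "\<And>s. g s \<in> borel \<rightarrow>\<^sub>M count_space UNIV"
    and x: "\<And>i. 1 \<le> i \<Longrightarrow> i \<le> n \<Longrightarrow> (\<lambda>\<omega>. x \<omega> i) \<in> borel_measurable M"
  shows "(\<lambda>\<omega>. run g s (x \<omega>) n) \<in> M \<rightarrow>\<^sub>M count_space UNIV"
  using x
proof (induction n)
  case (Suc n)
  have "(\<lambda>\<omega>. run g s (x \<omega>) n) \<in> M \<rightarrow>\<^sub>M count_space UNIV"
    by (rule Suc.IH) (auto intro: Suc.prems)
  moreover have "(\<lambda>\<omega>. g t (x \<omega> (Suc n))) \<in> M \<rightarrow>\<^sub>M count_space UNIV" for t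
    by (rule measurable_compose[OF _ g]) (auto intro: Suc.prems)
  ultimately show ?case
    by (auto intro: measurable_compose_countable)
qed auto

text \<open>
  The states up to time \<open>n\<close> are a measurable function of the inputs \<open>1, \<dots>, n\<close>, so every event
  about them is independent of input \<open>n + 1\<close>. This is what makes prefix
  probabilities computable by recursion on \<open>n\<close>.
\<close>

lemma (in prob_space) prob_run_next_input:
  fixes g :: "'s :: countable \<Rightarrow> real \<Rightarrow> 's"
  assumes g: "\<And>s. g s \<in> borel \<rightarrow>\<^sub>M count_space UNIV"
    and indep: "indep_vars (\<lambda>_. borel) \<xi> {1..}"
    and B: "B \<in> sets borel"
  shows "prob {\<omega> \<in> space M. (\<forall>i\<le>n. run g s (\<lambda>j. \<xi> j \<omega>) i \<in> C i) \<and> \<xi> (Suc n) \<omega> \<in> B}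
       = prob {\<omega> \<in> space M. \<forall>i\<le>n. run g s (\<lambda>j. \<xi> j \<omega>) i \<in> C i}
         * prob {\<omega> \<in> space M. \<xi> (Suc n) \<omega> \<in> B}"
proof -
  let ?past = "\<lambda>\<omega>. restrict (\<lambda>i. \<xi> i \<omega>) {1..n}"
  let ?next = "\<lambda>\<omega>. restrict (\<lambda>i. \<xi> i \<omega>) {Suc n}"
  let ?A = "{x \<in> space (PiM {1..n} (\<lambda>_. borel)). \<forall>i\<le>n. run g s x i \<in> C i}"
  let ?B = "{x \<in> space (PiM {Suc n} (\<lambda>_. borel)). x (Suc n) \<in> B}"
  have "{x \<in> space (PiM {1..n} (\<lambda>_. borel)). run g s x i \<in> C i} \<in> sets (PiM {1..n} (\<lambda>_. borel))"
    if "i \<le> n" for i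
  proof (rule measurable_sets_Collect[where N = "count_space UNIV" and P = "\<lambda>t. t \<in> C i"])
    show "(\<lambda>x. run g s x i) \<in> PiM {1..n} (\<lambda>_. borel) \<rightarrow>\<^sub>M count_space UNIV"
      by (rule measurable_run[OF g], rule measurable_component_singleton) (use that in auto)
  qed simp
  then have "{x \<in> space (PiM {1..n} (\<lambda>_. borel)). \<forall>i\<in>{..n}. run g s x i \<in> C i}
      \<in> sets (PiM {1..n} (\<lambda>_. borel))"
    by (intro sets.sets_Collect_finite_All) auto
  then have A: "?A \<in> sets (PiM {1..n} (\<lambda>_. borel))"
    by (simp only: Ball_def atMost_iff)
  have B': "?B \<in> sets (PiM {Suc n} (\<lambda>_. borel))"
    by (rule measurable_sets_Collect[where N = borel and P = "\<lambda>t. t \<in> B"],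
        rule measurable_component_singleton) (use B in simp_all)
  have "indep_var (PiM {1..n} (\<lambda>_. borel)) ?past (PiM {Suc n} (\<lambda>_. borel)) ?next"
    by (rule indep_var_restrict[OF indep]) auto
  from indep_varD[OF this A B']
  have "prob ((\<lambda>\<omega>. (?past \<omega>, ?next \<omega>)) -` (?A \<times> ?B) \<inter> space M)
      = prob (?past -` ?A \<inter> space M) * prob (?next -` ?B \<inter> space M)" .
  moreover have "run g s (?past \<omega>) i = run g s (\<lambda>j. \<xi> j \<omega>) i" if "i \<le> n" for i \<omega>
    using that by (intro run_cong) auto
  then have "?past -` ?A \<inter> space M = {\<omega> \<in> space M. \<forall>i\<le>n. run g s (\<lambda>j. \<xi> j \<omega>) i \<in> C i}"
    by (auto simp: space_PiM)
  moreover have "?next -` ?B \<inter> space M = {\<omega> \<in> space M. \<xi> (Suc n) \<omega> \<in> B}"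
    by (auto simp: space_PiM)
  moreover have "(\<lambda>\<omega>. (?past \<omega>, ?next \<omega>)) -` (?A \<times> ?B) \<inter> space M
      = (?past -` ?A \<inter> space M) \<inter> (?next -` ?B \<inter> space M)"
    by blast
  moreover have "{\<omega> \<in> space M. (\<forall>i\<le>n. run g s (\<lambda>j. \<xi> j \<omega>) i \<in> C i) \<and> \<xi> (Suc n) \<omega> \<in> B}
      = {\<omega> \<in> space M. \<forall>i\<le>n. run g s (\<lambda>j. \<xi> j \<omega>) i \<in> C i}
        \<inter> {\<omega> \<in> space M. \<xi> (Suc n) \<omega> \<in> B}"
    by blast
  ultimately show ?thesis
    by (simp only:)
qed

section \<open>Laws of countable-state processes\<close>

text \<open>
  Every cylinder event depends on a finite prefix of the sequence, and prefixes range over a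
  countable set of lists, so the law of a prefix is determined by its point masses.
\<close>

lemma distr_eq_if_prefix_probs_eq:
  fixes Z :: "'a \<Rightarrow> nat \<Rightarrow> nat" and W :: "'b \<Rightarrow> nat \<Rightarrow> nat"
  assumes "prob_space M" and "prob_space N"
    and Z: "\<And>n. (\<lambda>\<omega>. Z \<omega> n) \<in> M \<rightarrow>\<^sub>M count_space UNIV"
    and W: "\<And>n. (\<lambda>\<omega>. W \<omega> n) \<in> N \<rightarrow>\<^sub>M count_space UNIV"
    and eq: "\<And>n z. measure M {\<omega> \<in> space M. \<forall>i\<le>n. Z \<omega> i = z i}
                 = measure N {\<omega> \<in> space N. \<forall>i\<le>n. W \<omega> i = z i}"
  shows "distr M (PiM UNIV (\<lambda>_. count_space UNIV)) Z
       = distr N (PiM UNIV (\<lambda>_. count_space UNIV)) W"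
proof -
  interpret M: prob_space M by fact
  interpret N: prob_space N by fact
  let ?P = "PiM UNIV (\<lambda>_. count_space UNIV) :: (nat \<Rightarrow> nat) measure"
  define pre :: "nat \<Rightarrow> (nat \<Rightarrow> nat) \<Rightarrow> nat list" where "pre n z = map z [0..<Suc n]" for n z
  have pre_eq: "pre n z = xs \<longleftrightarrow> length xs = Suc n \<and> (\<forall>i\<le>n. z i = xs ! i)" for n z xs
    unfolding pre_def by (auto simp: list_eq_iff_nth_eq less_Suc_eq_le simp del: upt_Suc)
  have [measurable]: "Z \<in> M \<rightarrow>\<^sub>M ?P" "W \<in> N \<rightarrow>\<^sub>M ?P"
    using Z W by (auto intro!: measurable_PiM_single')
  have meas_pre: "(\<lambda>\<omega>. pre n (V \<omega>)) \<in> L \<rightarrow>\<^sub>M count_space UNIV"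
    if [measurable]: "\<And>n. (\<lambda>\<omega>. V \<omega> n) \<in> L \<rightarrow>\<^sub>M count_space UNIV" for n V and L :: "'c measure"
  proof -
    have "{\<omega> \<in> space L. pre n (V \<omega>) = xs} \<in> sets L" for xs
      unfolding pre_eq by measurable
    then show ?thesis
      by (subst measurable_count_space_eq2_countable) (auto simp: vimage_def Int_def conj_commute)
  qed
  have law_pre: "distr M (count_space UNIV) (\<lambda>\<omega>. pre n (Z \<omega>))
      = distr N (count_space UNIV) (\<lambda>\<omega>. pre n (W \<omega>))" for n
  proof (rule measure_eqI_countable[where A = UNIV])
    fix xs :: "nat list"
    have "(\<lambda>\<omega>. pre n (V \<omega>)) -` {xs} \<inter> S
        = (if length xs = Suc n then {\<omega> \<in> S. \<forall>i\<le>n. V \<omega> i = xs ! i} else {})"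
      for V :: "'c \<Rightarrow> nat \<Rightarrow> nat" and S :: "'c set"
      using pre_eq[of n "V _" xs] by (auto simp: vimage_def)
    note pre_vimage = this[of Z] this[of W]
    then show "emeasure (distr M (count_space UNIV) (\<lambda>\<omega>. pre n (Z \<omega>))) {xs}
        = emeasure (distr N (count_space UNIV) (\<lambda>\<omega>. pre n (W \<omega>))) {xs}"
      using eq[of n "\<lambda>i. xs ! i"]
      by (simp add: emeasure_distr meas_pre Z W M.emeasure_eq_measure N.emeasure_eq_measure)
  qed auto
  show ?thesis
  proof (rule measure_eqI_PiM_infinite)
    fix A :: "nat \<Rightarrow> nat set" and J :: "nat set"
    assume J: "finite J"
    define n where "n = Max (insert 0 J)"
    have n: "j \<le> n" if "j \<in> J" for j
      using that J by (auto simp: n_def)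
    define L where "L = {xs. \<forall>j\<in>J. xs ! j \<in> A j}"
    have cyl: "prod_emb UNIV (\<lambda>_. count_space UNIV) J (Pi\<^sub>E J A) = {z. pre n z \<in> L}"
      using n by (fastforce simp: prod_emb_def L_def pre_def simp del: upt_Suc)
    have sets: "{z. pre n z \<in> L} \<in> sets ?P"
      unfolding cyl[symmetric] by (rule sets_PiM_I) (use J in auto)
    have "emeasure (distr M ?P Z) {z. pre n z \<in> L}
        = emeasure (distr M (count_space UNIV) (\<lambda>\<omega>. pre n (Z \<omega>))) L"
      using sets by (simp add: emeasure_distr meas_pre Z vimage_def)
    also have "\<dots> = emeasure (distr N ?P W) {z. pre n z \<in> L}"
      using sets unfolding law_pre by (simp add: emeasure_distr meas_pre W vimage_def)
    finally show "emeasure (distr M ?P Z) (prod_emb UNIV (\<lambda>_. count_space UNIV) J (Pi\<^sub>E J A))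
        = emeasure (distr N ?P W) (prod_emb UNIV (\<lambda>_. count_space UNIV) J (Pi\<^sub>E J A))"
      unfolding cyl .
  next
    show "finite_measure (distr M ?P Z)"
      by (rule prob_space.finite_measure[OF M.prob_space_distr]) simp
  qed auto
qed

section \<open>The upward probability of the absolute walk\<close>

text \<open>
  The value at \<open>0\<close> is not the one that the quotient would give: for \<open>k > 0\<close> the denominator
  accounts for the two states \<open>k\<close> and \<open>- k\<close>, which coincide for \<open>k = 0\<close>.
\<close>

definition up_prob :: "real \<Rightarrow> nat \<Rightarrow> real" where
  "up_prob p k = (if k = 0 then 1
     else (p ^ Suc k + (1 - p) ^ Suc k) / (p ^ k + (1 - p) ^ k))"

definition transition :: "real \<Rightarrow> nat \<Rightarrow> nat \<Rightarrow> real" where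
  "transition p k l =
     (if l = Suc k then up_prob p k else if k = Suc l then 1 - up_prob p k else 0)"

lemma power_sum_pos:
  fixes p :: real
  assumes "p \<in> {0..1}"
  shows "p ^ k + (1 - p) ^ k > 0"
proof (cases "p = 0")
  case False
  with assms have "p ^ k > 0" "(1 - p) ^ k \<ge> 0" by auto
  then show ?thesis by linarith
qed (auto intro: add_nonneg_pos)

lemma up_prob_bounds:
  assumes "p \<in> {0..1}"
  shows "up_prob p k \<in> {0..1}"
proof -
  have "p ^ Suc k \<le> p ^ k" "(1 - p) ^ Suc k \<le> (1 - p) ^ k" "0 \<le> p ^ Suc k" "0 \<le> (1 - p) ^ Suc k"
    using assms by (auto intro!: mult_left_le_one_le)
  then show ?thesis
    using power_sum_pos[OF assms, of k] by (auto simp: up_prob_def simp del: power_Suc)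
qed

lemma up_prob_reflect: "up_prob (1 - p) k = up_prob p k"
  by (simp add: up_prob_def add.commute)

text \<open>
  In this form both factors of the product increase with \<open>p\<close> on the upper half of the unit
  interval, and both are nonnegative there.
\<close>

lemma up_prob_eq:
  assumes "p \<in> {0..1}" and "k > 0"
  shows "up_prob p k
       = 1 / 2 + (2 * p - 1) / 2 * ((p ^ k - (1 - p) ^ k) / (p ^ k + (1 - p) ^ k))"
  using assms power_sum_pos[OF assms(1), of k]
  by (simp add: up_prob_def divide_simps) (simp add: algebra_simps)

lemma up_prob_mono_upper_half:
  assumes "1 / 2 \<le> p" and "p \<le> p'" and "p' \<le> 1"
  shows "up_prob p k \<le> up_prob p' k"
proof (cases "k = 0")
  case False
  define q q' where "q = 1 - p" and "q' = 1 - p'"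
  have ord: "0 \<le> q'" "q' \<le> q" "q \<le> p" "0 \<le> p"
    using assms by (auto simp: q_def q'_def)
  have pos: "p ^ k + q ^ k > 0" "p' ^ k + q' ^ k > 0"
    using assms unfolding q_def q'_def by (auto intro!: power_sum_pos)
  \<comment> \<open>Cross-multiplied, the inequality between the two ratios is \<open>q'\<^sup>k p\<^sup>k \<le> p'\<^sup>k q\<^sup>k\<close>.\<close>
  have "q' ^ k * p ^ k \<le> p' ^ k * q ^ k"
    using ord assms by (subst mult.commute) (intro mult_mono power_mono; simp)
  then have ratio: "(p ^ k - q ^ k) / (p ^ k + q ^ k) \<le> (p' ^ k - q' ^ k) / (p' ^ k + q' ^ k)"
    using pos by (simp add: field_simps)
  have "0 \<le> (p ^ k - q ^ k) / (p ^ k + q ^ k)"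
    using ord pos by (intro divide_nonneg_pos) (auto intro!: power_mono)
  then have "(2 * p - 1) / 2 * ((p ^ k - q ^ k) / (p ^ k + q ^ k))
      \<le> (2 * p' - 1) / 2 * ((p' ^ k - q' ^ k) / (p' ^ k + q' ^ k))"
    using ratio assms by (intro mult_mono) auto
  then show ?thesis
    using False assms by (simp add: up_prob_eq q_def q'_def)
qed (simp add: up_prob_def)

lemma up_prob_mono_dist:
  assumes "p \<in> {0..1}" and "p' \<in> {0..1}" and "\<bar>p - 1 / 2\<bar> \<le> \<bar>p' - 1 / 2\<bar>"
  shows "up_prob p k \<le> up_prob p' k"
proof -
  have upper: "up_prob r k = up_prob (1 / 2 + \<bar>r - 1 / 2\<bar>) k" for r
    using up_prob_reflect[of r k] by (cases "r \<ge> 1 / 2") (auto simp: abs_if)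
  show ?thesis
    unfolding upper[of p] upper[of p']
    using assms by (intro up_prob_mono_upper_half) (auto simp: abs_if split: if_splits)
qed

section \<open>The monotone coupling\<close>

text \<open>
  The case \<open>k = 0\<close> is listed separately, although \<open>up_prob p 0 = 1\<close>, so that the step up from \<open>0\<close>
  is taken for every real \<open>u\<close> and the parity argument holds pointwise rather than almost surely.
\<close>

definition abs_step :: "real \<Rightarrow> nat \<Rightarrow> real \<Rightarrow> nat" where
  "abs_step p k u = (if k = 0 \<or> u \<le> up_prob p k then Suc k else k - 1)"

text \<open>
  The order alone is not preserved by a common step: from \<open>k\<close> and \<open>k + 1\<close> the chains could
  cross. The induction therefore carries along that the states have the same parity.
\<close>

lemma run_abs_step_mono:
  assumes "\<And>k. up_prob p k \<le> up_prob p' k"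
  shows "run (abs_step p) 0 u n \<le> run (abs_step p') 0 u n"
proof -
  have "run (abs_step p) 0 u n \<le> run (abs_step p') 0 u n
      \<and> even (run (abs_step p') 0 u n - run (abs_step p) 0 u n)"
  proof (induction n)
    case (Suc n)
    define a b where "a = run (abs_step p) 0 u n" and "b = run (abs_step p') 0 u n"
    from Suc.IH obtain d where d: "b = a + 2 * d"
      unfolding a_def b_def by (metis le_add_diff_inverse evenE)
    have "abs_step p a v \<le> abs_step p' b v \<and> even (abs_step p' b v - abs_step p a v)" for v
    proof (cases "d = 0")
      case True
      then show ?thesis
        using d assms[of a] by (auto simp: abs_step_def)
    next
      case False
      \<comment> \<open>The gap is at least 2, which one step up below and one step down above only just close.\<close>
      then obtain e where "d = Suc e" by (cases d) auto
      then show ?thesis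
        using d by (auto simp: abs_step_def)
    qed
    then show ?case by (simp add: a_def b_def)
  qed simp
  then show ?thesis ..
qed

definition uniform_seq :: "(nat \<Rightarrow> real) measure" where
  "uniform_seq = PiM UNIV (\<lambda>_. uniform_measure lborel {0..1})"

lemma prob_space_unit: "prob_space (uniform_measure lborel {0..1 :: real})"
  by (rule prob_space_uniform_measure) auto

lemma prob_space_uniform_seq: "prob_space uniform_seq"
  unfolding uniform_seq_def by (rule prob_space_PiM[OF prob_space_unit])

lemma measurable_uniform_seq_coord [measurable]: "(\<lambda>u. u i) \<in> borel_measurable uniform_seq"
  unfolding uniform_seq_def
  by (rule measurable_compose[OF measurable_component_singleton]) auto

lemma distr_uniform_seq_coord:
  "distr uniform_seq borel (\<lambda>u. u i) = uniform_measure lborel {0..1}"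
proof -
  have "distr uniform_seq borel (\<lambda>u. u i)
      = distr uniform_seq (uniform_measure lborel {0..1}) (\<lambda>u. u i)"
    by (rule distr_cong) auto
  also have "\<dots> = uniform_measure lborel {0..1}"
    unfolding uniform_seq_def by (rule distr_PiM_component[OF prob_space_unit]) auto
  finally show ?thesis .
qed

lemma indep_vars_uniform_seq:
  "prob_space.indep_vars uniform_seq (\<lambda>_. borel) (\<lambda>i u. u i) I"
proof -
  interpret prob_space uniform_seq by (rule prob_space_uniform_seq)
  have "distr uniform_seq (PiM UNIV (\<lambda>_. borel)) (\<lambda>u. \<lambda>i\<in>UNIV. u i)
      = distr uniform_seq uniform_seq (\<lambda>u. u)"
    by (rule distr_cong) (auto simp: uniform_seq_def intro!: sets_PiM_cong)
  then have "indep_vars (\<lambda>_. borel) (\<lambda>i u. u i) (UNIV :: nat set)"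
    by (subst indep_vars_iff_distr_eq_PiM)
       (auto simp: distr_uniform_seq_coord distr_id uniform_seq_def[symmetric])
  then show ?thesis by (rule indep_vars_subset) auto
qed

lemma prob_uniform_seq_le:
  assumes "c \<in> {0..1}"
  shows "measure uniform_seq {u \<in> space uniform_seq. u i \<le> c} = c"
proof -
  have "measure uniform_seq {u \<in> space uniform_seq. u i \<le> c}
      = measure (distr uniform_seq borel (\<lambda>u. u i)) {..c}"
    by (subst measure_distr) (auto intro!: arg_cong[where f = "measure uniform_seq"])
  also have "\<dots> = measure lborel ({0..1} \<inter> {..c})"
    unfolding distr_uniform_seq_coord by (subst measure_uniform_measure) auto
  also have "{0..1} \<inter> {..c} = {0..c}" using assms by auto
  finally show ?thesis using assms by simp
qed

lemma measurable_abs_step: "abs_step p k \<in> borel \<rightarrow>\<^sub>M count_space UNIV"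
  unfolding abs_step_def by measurable

lemma prob_abs_step:
  assumes "p \<in> {0..1}"
  shows "measure uniform_seq {u \<in> space uniform_seq. abs_step p k (u i) = l} = transition p k l"
proof -
  interpret prob_space uniform_seq by (rule prob_space_uniform_seq)
  let ?U = "{u \<in> space uniform_seq. u i \<le> up_prob p k}"
  have U: "prob ?U = up_prob p k"
    using assms by (intro prob_uniform_seq_le up_prob_bounds)
  have "?U \<in> events" by measurable
  then have D: "prob (space uniform_seq - ?U) = 1 - up_prob p k"
    by (simp add: prob_compl U)
  consider "k = 0" | "k > 0" "l = Suc k" | "k > 0" "k = Suc l" | "k > 0" "l \<noteq> Suc k" "k \<noteq> Suc l"
    by blast
  then show ?thesis
  proof cases
    case 1
    then show ?thesis
      using prob_space by (auto simp: abs_step_def transition_def up_prob_def)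
  next
    case 2
    then have "{u \<in> space uniform_seq. abs_step p k (u i) = l} = ?U"
      by (auto simp: abs_step_def)
    then show ?thesis using 2 U by (simp add: transition_def)
  next
    case 3
    then have "{u \<in> space uniform_seq. abs_step p k (u i) = l} = space uniform_seq - ?U"
      by (auto simp: abs_step_def)
    then show ?thesis using 3 D by (simp add: transition_def)
  next
    case 4
    then have empty: "{u \<in> space uniform_seq. abs_step p k (u i) = l} = {}"
      by (auto simp: abs_step_def)
    show ?thesis using 4 unfolding empty by (simp add: transition_def)
  qed
qed

lemma prefix_prob_coupled_chain:
  assumes "p \<in> {0..1}"
  shows "measure uniform_seq {u \<in> space uniform_seq. \<forall>i\<le>n. run (abs_step p) 0 u i = z i}
       = (if z 0 = 0 then \<Prod>i<n. transition p (z i) (z (Suc i)) else 0)"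
proof (induction n)
  interpret prob_space uniform_seq by (rule prob_space_uniform_seq)
  case 0
  show ?case using prob_space by (auto simp: eq_commute[of 0])
next
  interpret prob_space uniform_seq by (rule prob_space_uniform_seq)
  case (Suc n)
  let ?B = "{v. abs_step p (z n) v = z (Suc n)}"
  have "?B = abs_step p (z n) -` {z (Suc n)} \<inter> space borel" by auto
  then have B: "?B \<in> sets borel"
    using measurable_sets[OF measurable_abs_step[of p "z n"], of "{z (Suc n)}"] by simp
  have "{u \<in> space uniform_seq. \<forall>i\<le>Suc n. run (abs_step p) 0 u i = z i}
      = {u \<in> space uniform_seq. (\<forall>i\<le>n. run (abs_step p) 0 (\<lambda>j. u j) i \<in> {z i}) \<and> u (Suc n) \<in> ?B}"
    by (auto simp: all_le_Suc_eq)
  then show ?case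
    using prob_run_next_input[OF measurable_abs_step indep_vars_uniform_seq B,
        where s = 0 and n = n and C = "\<lambda>i. {z i}"] Suc.IH prob_abs_step[OF assms]
    by simp
qed

section \<open>The absolute value of the Bernoulli walk\<close>

definition sign_step :: "int \<Rightarrow> real \<Rightarrow> int" where
  "sign_step s x = (if x = 1 then s + 1 else s - 1)"

lemma measurable_sign_step: "sign_step s \<in> borel \<rightarrow>\<^sub>M count_space UNIV"
  unfolding sign_step_def by measurable

text \<open>
  Up to a factor depending only on the history of absolute values, this is the probability that the
  signed walk is at \<open>s\<close>.
\<close>

definition signed_weight :: "real \<Rightarrow> int \<Rightarrow> real" where
  "signed_weight p s = (if s \<ge> 0 then p ^ nat s else (1 - p) ^ nat (- s))"

lemma signed_weight_simps [simp]:
  "signed_weight p (int k) = p ^ k"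
  "signed_weight p (- int k) = (1 - p) ^ k"
  by (auto simp: signed_weight_def)

text \<open>
  The change, in a step of the absolute value from \<open>k\<close> to \<open>l\<close>, of the factor that multiplies
  \<open>signed_weight\<close>. A step away from \<open>0\<close> changes the weight itself by \<open>p\<close> or \<open>1 - p\<close>; a step towards
  \<open>0\<close> has the opposite sign but lowers the exponent of the weight, which leaves \<open>p (1 - p)\<close>. At \<open>0\<close>
  the positive and the negative branch merge, hence the 2.
\<close>

definition weight_factor :: "real \<Rightarrow> nat \<Rightarrow> nat \<Rightarrow> real" where
  "weight_factor p k l =
     (if l = Suc k then 1
      else if k = Suc l then (if l = 0 then 2 else 1) * (p * (1 - p)) else 0)"

text \<open>
  The sum of \<open>signed_weight p s\<close> over the integers \<open>s\<close> with absolute value \<open>k\<close>; for \<open>k = 0\<close> there is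
  only one of them.
\<close>

definition abs_weight :: "real \<Rightarrow> nat \<Rightarrow> real" where
  "abs_weight p k = (if k = 0 then 1 else p ^ k + (1 - p) ^ k)"

text \<open>
  The factors of the signed walk turn into transition probabilities after division by the total
  weight at each level. For a step down from \<open>l + 1\<close> the identity behind this is
  \<open>p\<^bsup>l+1\<^esup> + q\<^bsup>l+1\<^esup> - (p\<^bsup>l+2\<^esup> + q\<^bsup>l+2\<^esup>) = p q (p\<^sup>l + q\<^sup>l)\<close> with \<open>q = 1 - p\<close>.
\<close>

lemma weight_factor_abs_weight:
  assumes "p \<in> {0..1}"
  shows "weight_factor p k l * abs_weight p l = transition p k l * abs_weight p k"
proof -
  have pos: "p ^ Suc l + (1 - p) ^ Suc l > 0" "p ^ k + (1 - p) ^ k > 0"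
    using power_sum_pos[OF assms] by blast+
  consider "l = Suc k" | "k = Suc l" "l = 0" | "k = Suc l" "l > 0" | "l \<noteq> Suc k" "k \<noteq> Suc l"
    by blast
  then show ?thesis
  proof cases
    case 1
    then show ?thesis
      using pos by (auto simp: weight_factor_def abs_weight_def transition_def up_prob_def)
  next
    case 2
    then show ?thesis
      by (simp add: weight_factor_def abs_weight_def transition_def up_prob_def algebra_simps
          power2_eq_square)
  next
    case 3
    have "(1 - up_prob p (Suc l)) * (p ^ Suc l + (1 - p) ^ Suc l)
        = p ^ Suc l + (1 - p) ^ Suc l - (p ^ Suc (Suc l) + (1 - p) ^ Suc (Suc l))"
      using pos(1) by (simp add: up_prob_def left_diff_distrib del: power_Suc)
    also have "\<dots> = p * (1 - p) * (p ^ l + (1 - p) ^ l)"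
      by (simp add: algebra_simps)
    finally show ?thesis
      using 3 by (simp add: weight_factor_def abs_weight_def transition_def del: power_Suc)
  next
    case 4
    then show ?thesis by (simp add: weight_factor_def transition_def)
  qed
qed

lemma prod_weight_factor:
  assumes "p \<in> {0..1}" and "z 0 = 0"
  shows "(\<Prod>i<n. weight_factor p (z i) (z (Suc i))) * abs_weight p (z n)
       = (\<Prod>i<n. transition p (z i) (z (Suc i)))"
proof (induction n)
  case (Suc n)
  have "(\<Prod>i<Suc n. weight_factor p (z i) (z (Suc i))) * abs_weight p (z (Suc n))
      = (\<Prod>i<n. weight_factor p (z i) (z (Suc i)))
        * (weight_factor p (z n) (z (Suc n)) * abs_weight p (z (Suc n)))"
    by simp
  also have "\<dots> = ((\<Prod>i<n. weight_factor p (z i) (z (Suc i))) * abs_weight p (z n))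
        * transition p (z n) (z (Suc n))"
    by (simp add: weight_factor_abs_weight[OF assms(1)])
  also have "\<dots> = (\<Prod>i<Suc n. transition p (z i) (z (Suc i)))"
    by (simp add: Suc.IH)
  finally show ?case .
qed (simp add: assms(2) abs_weight_def)

context bernoulli_steps
begin

text \<open>
  An integer-valued version of the walk. Every step other than \<open>1\<close> counts as a step down, which
  alters the walk on a null set only.
\<close>

definition int_walk :: "'a \<Rightarrow> nat \<Rightarrow> int" where
  "int_walk \<omega> n = run sign_step 0 (\<lambda>j. X j \<omega>) n"

lemma int_walk_simps [simp]:
  "int_walk \<omega> 0 = 0"
  "int_walk \<omega> (Suc n) = (if X (Suc n) \<omega> = 1 then int_walk \<omega> n + 1 else int_walk \<omega> n - 1)"
  by (simp_all add: int_walk_def sign_step_def)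

lemma measurable_step: "i \<ge> 1 \<Longrightarrow> X i \<in> borel_measurable M"
  using indep_steps by (auto simp: indep_vars_def)

lemma measurable_int_walk [measurable]:
  "(\<lambda>\<omega>. int_walk \<omega> n) \<in> M \<rightarrow>\<^sub>M count_space UNIV"
  unfolding int_walk_def by (intro measurable_run measurable_sign_step measurable_step)

lemma prob_not_up:
  assumes "n \<ge> 1"
  shows "prob {\<omega> \<in> space M. X n \<omega> \<noteq> 1} = 1 - p"
proof -
  have [measurable]: "X n \<in> borel_measurable M" by (rule measurable_step[OF assms])
  have "prob (space M - {\<omega> \<in> space M. X n \<omega> = 1}) = 1 - p"
    by (subst prob_compl) (auto simp: prob_up[OF assms])
  moreover have "space M - {\<omega> \<in> space M. X n \<omega> = 1} = {\<omega> \<in> space M. X n \<omega> \<noteq> 1}" by auto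
  ultimately show ?thesis by simp
qed

lemma AE_step:
  assumes "n \<ge> 1"
  shows "AE \<omega> in M. X n \<omega> = 1 \<or> X n \<omega> = - 1"
proof -
  have [measurable]: "X n \<in> borel_measurable M" by (rule measurable_step[OF assms])
  have "prob ({\<omega> \<in> space M. X n \<omega> = 1} \<union> {\<omega> \<in> space M. X n \<omega> = - 1}) = 1"
    by (subst finite_measure_Union) (auto simp: prob_up[OF assms] prob_down[OF assms])
  then show ?thesis
    by (rule AE_mp[OF AE_prob_1]) auto
qed

lemma AE_walk_eq_int_walk: "AE \<omega> in M. \<forall>n. walk X n \<omega> = of_int (int_walk \<omega> n)"
proof -
  have "AE \<omega> in M. \<forall>n. n \<ge> 1 \<longrightarrow> X n \<omega> = 1 \<or> X n \<omega> = - 1"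
    using AE_step by (auto simp: AE_all_countable)
  then show ?thesis
  proof (eventually_elim, intro allI)
    fix \<omega> n
    assume *: "\<forall>n. n \<ge> 1 \<longrightarrow> X n \<omega> = 1 \<or> X n \<omega> = - 1"
    show "walk X n \<omega> = of_int (int_walk \<omega> n)"
    proof (induction n)
      case (Suc n)
      then show ?case using *[rule_format, of "Suc n"] by (auto simp: walk_def)
    qed (simp add: walk_def)
  qed
qed

definition joint_prob :: "(nat \<Rightarrow> nat) \<Rightarrow> nat \<Rightarrow> int \<Rightarrow> real" where
  "joint_prob z n s =
     prob {\<omega> \<in> space M. (\<forall>i\<le>n. nat \<bar>int_walk \<omega> i\<bar> = z i) \<and> int_walk \<omega> n = s}"

lemma joint_prob_eq_0: "nat \<bar>s\<bar> \<noteq> z n \<Longrightarrow> joint_prob z n s = 0"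
proof -
  assume "nat \<bar>s\<bar> \<noteq> z n"
  then have "{\<omega> \<in> space M. (\<forall>i\<le>n. nat \<bar>int_walk \<omega> i\<bar> = z i) \<and> int_walk \<omega> n = s} = {}" by auto
  then show ?thesis unfolding joint_prob_def by (simp only: measure_empty)
qed

lemma joint_prob_step:
  assumes B: "B \<in> sets borel"
  shows "prob {\<omega> \<in> space M. ((\<forall>i\<le>n. nat \<bar>int_walk \<omega> i\<bar> = z i) \<and> int_walk \<omega> n = s) \<and> X (Suc n) \<omega> \<in> B}
      = joint_prob z n s * prob {\<omega> \<in> space M. X (Suc n) \<omega> \<in> B}"
proof -
  define C where "C i = {t :: int. nat \<bar>t\<bar> = z i \<and> (i = n \<longrightarrow> t = s)}" for i :: nat
  have "(\<forall>i\<le>n. nat \<bar>int_walk \<omega> i\<bar> = z i) \<and> int_walk \<omega> n = s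
      \<longleftrightarrow> (\<forall>i\<le>n. run sign_step 0 (\<lambda>j. X j \<omega>) i \<in> C i)" for \<omega>
    by (auto simp: C_def int_walk_def)
  then show ?thesis
    unfolding joint_prob_def
    using prob_run_next_input[OF measurable_sign_step indep_steps B,
        where s = 0 and n = n and C = C] by simp
qed

lemma joint_prob_Suc:
  assumes "nat \<bar>s\<bar> = z (Suc n)"
  shows "joint_prob z (Suc n) s
       = p * joint_prob z n (s - 1) + (1 - p) * joint_prob z n (s + 1)"
proof -
  have [measurable]: "X (Suc n) \<in> borel_measurable M" by (rule measurable_step) simp
  let ?E = "\<lambda>t \<omega>. (\<forall>i\<le>n. nat \<bar>int_walk \<omega> i\<bar> = z i) \<and> int_walk \<omega> n = t"
  let ?U = "{\<omega> \<in> space M. ?E (s - 1) \<omega> \<and> X (Suc n) \<omega> \<in> {1}}"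
  let ?D = "{\<omega> \<in> space M. ?E (s + 1) \<omega> \<and> X (Suc n) \<omega> \<in> - {1}}"
  have "{\<omega> \<in> space M. (\<forall>i\<le>Suc n. nat \<bar>int_walk \<omega> i\<bar> = z i) \<and> int_walk \<omega> (Suc n) = s} = ?U \<union> ?D"
    using assms by (auto simp: le_Suc_eq)
  then have "joint_prob z (Suc n) s = prob (?U \<union> ?D)"
    by (simp only: joint_prob_def)
  also have "\<dots> = prob ?U + prob ?D"
    by (rule finite_measure_Union) (measurable, auto)
  also have "prob ?U = p * joint_prob z n (s - 1)"
    by (subst joint_prob_step) (auto simp: prob_up)
  also have "prob ?D = (1 - p) * joint_prob z n (s + 1)"
    by (subst joint_prob_step) (auto simp: prob_not_up)
  finally show ?thesis .
qed

text \<open>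
  The sign of the walk is, given the history of absolute values, distributed according to
  \<open>signed_weight\<close>: the factor in front depends on \<open>z\<close> but not on \<open>s\<close>. In the induction, a point
  \<open>s\<close> away from \<open>0\<close> has only one neighbour at the previous level, and \<open>0\<close> has the two neighbours
  \<open>1\<close> and \<open>- 1\<close>.
\<close>

lemma joint_prob_eq_weight:
  assumes "nat \<bar>s\<bar> = z n"
  shows "joint_prob z n s
       = (if z 0 = 0 then \<Prod>i<n. weight_factor p (z i) (z (Suc i)) else 0) * signed_weight p s"
  using assms
proof (induction n arbitrary: s)
  case 0
  then show ?case
    by (auto simp: joint_prob_def prob_space signed_weight_def)
next
  case (Suc n)
  define c where "c = (if z 0 = 0 then \<Prod>i<n. weight_factor p (z i) (z (Suc i)) else 0)"
  define k l where "k = z n" and "l = z (Suc n)"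
  have on: "joint_prob z n t = c * signed_weight p t" if "nat \<bar>t\<bar> = k" for t
    using Suc.IH[of t] that by (simp add: c_def k_def)
  have off: "joint_prob z n t = 0" if "nat \<bar>t\<bar> \<noteq> k" for t
    using that by (intro joint_prob_eq_0) (simp add: k_def)
  have rec: "joint_prob z (Suc n) s
      = p * joint_prob z n (s - 1) + (1 - p) * joint_prob z n (s + 1)"
    by (rule joint_prob_Suc) (rule Suc.prems)
  have s: "s = int l \<or> s = - int l"
    using Suc.prems unfolding l_def by linarith
  have "joint_prob z (Suc n) s = c * weight_factor p k l * signed_weight p s"
  proof -
    consider "l = Suc k" | "k = Suc l" "l = 0" | "k = Suc l" "l > 0" | "l \<noteq> Suc k" "k \<noteq> Suc l"
      by blast
    then show ?thesis
    proof cases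
      case 1
      from s show ?thesis
      proof
        assume sl: "s = int l"
        then have w: "signed_weight p s = p ^ l" by simp
        have J: "joint_prob z n (s - 1) = c * p ^ k" "joint_prob z n (s + 1) = 0"
          using 1 sl on[of "int k"] by (auto intro!: off simp: add.commute)
        show ?thesis
          using 1 by (simp add: rec weight_factor_def w J)
      next
        assume sl: "s = - int l"
        then have w: "signed_weight p s = (1 - p) ^ l" by simp
        have J: "joint_prob z n (s - 1) = 0" "joint_prob z n (s + 1) = c * (1 - p) ^ k"
          using 1 sl on[of "- int k"] by (auto intro!: off simp: add.commute)
        show ?thesis
          using 1 by (simp add: rec weight_factor_def w J)
      qed
    next
      case 2
      have s0: "s = 0" using s 2 by simp
      then have J: "joint_prob z n (s - 1) = c * (1 - p)" "joint_prob z n (s + 1) = c * p"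
        using 2 on[of 1] on[of "- 1"] by (auto simp: signed_weight_def)
      have w: "signed_weight p s = 1" using s0 by (simp add: signed_weight_def)
      show ?thesis
        using 2 by (simp add: rec weight_factor_def w J)
    next
      case 3
      from s show ?thesis
      proof
        assume sl: "s = int l"
        then have w: "signed_weight p s = p ^ l" by simp
        have "s + 1 = int k" using 3 sl by simp
        then have J: "joint_prob z n (s + 1) = c * p ^ k" using on[of "int k"] by simp
        have J0: "joint_prob z n (s - 1) = 0" by (rule off) (use 3 sl in linarith)
        show ?thesis
          using 3 by (simp add: rec weight_factor_def w J J0)
      next
        assume sl: "s = - int l"
        then have w: "signed_weight p s = (1 - p) ^ l" by simp
        have "s - 1 = - int k" using 3 sl by simp
        then have J: "joint_prob z n (s - 1) = c * (1 - p) ^ k" using on[of "- int k"] by simp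
        have J0: "joint_prob z n (s + 1) = 0" by (rule off) (use 3 sl in linarith)
        show ?thesis
          using 3 by (simp add: rec weight_factor_def w J J0)
      qed
    next
      case 4
      with s have "nat \<bar>s - 1\<bar> \<noteq> k \<and> nat \<bar>s + 1\<bar> \<noteq> k"
        by - (elim disjE; auto)
      then show ?thesis
        using 4 by (simp add: rec off weight_factor_def)
    qed
  qed
  then show ?case
    by (simp add: c_def k_def l_def)
qed

lemma prefix_prob_abs_walk:
  "prob {\<omega> \<in> space M. \<forall>i\<le>n. nat \<bar>int_walk \<omega> i\<bar> = z i}
   = (if z 0 = 0 then \<Prod>i<n. transition p (z i) (z (Suc i)) else 0)"
proof -
  let ?E = "\<lambda>s. {\<omega> \<in> space M. (\<forall>i\<le>n. nat \<bar>int_walk \<omega> i\<bar> = z i) \<and> int_walk \<omega> n = s}"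
  define c where "c = (if z 0 = 0 then \<Prod>i<n. weight_factor p (z i) (z (Suc i)) else 0)"
  have J: "prob (?E s) = c * signed_weight p s" if "nat \<bar>s\<bar> = z n" for s
    using joint_prob_eq_weight[where z = z and n = n, OF that] by (simp add: joint_prob_def c_def)
  have split: "{\<omega> \<in> space M. \<forall>i\<le>n. nat \<bar>int_walk \<omega> i\<bar> = z i}
      = ?E (int (z n)) \<union> ?E (- int (z n))"
  proof -
    have "nat \<bar>t\<bar> = z n \<longleftrightarrow> t = int (z n) \<or> t = - int (z n)" for t :: int
      by linarith
    then show ?thesis by blast
  qed
  have "prob {\<omega> \<in> space M. \<forall>i\<le>n. nat \<bar>int_walk \<omega> i\<bar> = z i} = c * abs_weight p (z n)"
  proof (cases "z n = 0")
    case True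
    then show ?thesis
      using J[of 0] by (simp add: split abs_weight_def signed_weight_def)
  next
    case False
    have "prob (?E (int (z n)) \<union> ?E (- int (z n)))
        = prob (?E (int (z n))) + prob (?E (- int (z n)))"
      by (rule finite_measure_Union) (measurable, use False in auto)
    then show ?thesis
      using False by (simp add: split J abs_weight_def distrib_left)
  qed
  then show ?thesis
    using prod_weight_factor[OF p_in_unit, of z n] by (auto simp: c_def)
qed

lemma distr_abs_walk:
  "distr M (PiM UNIV (\<lambda>_. count_space UNIV)) (\<lambda>\<omega> n. nat \<bar>int_walk \<omega> n\<bar>)
   = distr uniform_seq (PiM UNIV (\<lambda>_. count_space UNIV)) (run (abs_step p) 0)"
proof (rule distr_eq_if_prefix_probs_eq)
  show "(\<lambda>u. run (abs_step p) 0 u n) \<in> uniform_seq \<rightarrow>\<^sub>M count_space UNIV" for n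
    by (intro measurable_run measurable_abs_step) measurable
qed (auto simp: prefix_prob_abs_walk prefix_prob_coupled_chain[OF p_in_unit]
       prob_space_axioms prob_space_uniform_seq)

lemma measurable_abs_walk: "(\<lambda>\<omega> n. \<bar>walk X n \<omega>\<bar>) \<in> borel_measurable M"
proof (rule measurable_coordinatewise_then_product)
  show "(\<lambda>\<omega>. \<bar>walk X n \<omega>\<bar>) \<in> borel_measurable M" for n
    unfolding walk_def by (intro borel_measurable_abs borel_measurable_sum measurable_step) auto
qed

text \<open>
  All expectations are moved to one space, that of the uniform sequence, where the chains for
  different values of \<open>p\<close> can be compared pointwise.
\<close>

lemma integral_abs_walk:
  fixes f :: "(nat \<Rightarrow> real) \<Rightarrow> real"
  assumes [measurable]: "f \<in> borel_measurable borel"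
  shows "(\<integral>\<omega>. f (\<lambda>n. \<bar>walk X n \<omega>\<bar>) \<partial>M)
       = (\<integral>u. f (\<lambda>n. real (run (abs_step p) 0 u n)) \<partial>uniform_seq)"
proof -
  let ?P = "PiM UNIV (\<lambda>_. count_space UNIV) :: (nat \<Rightarrow> nat) measure"
  have real_meas: "(\<lambda>z n. real (z n)) \<in> borel_measurable ?P"
    by (intro measurable_coordinatewise_then_product
          measurable_compose[OF measurable_component_singleton]) auto
  then have F: "(\<lambda>z. f (\<lambda>n. real (z n))) \<in> borel_measurable ?P"
    by (rule measurable_compose) fact
  have V: "(\<lambda>\<omega> n. nat \<bar>int_walk \<omega> n\<bar>) \<in> M \<rightarrow>\<^sub>M ?P"
    by (rule measurable_PiM_single') auto
  have Z: "run (abs_step p) 0 \<in> uniform_seq \<rightarrow>\<^sub>M ?P"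
    by (rule measurable_PiM_single') (auto intro!: measurable_run measurable_abs_step)
  have "(\<integral>\<omega>. f (\<lambda>n. \<bar>walk X n \<omega>\<bar>) \<partial>M) = (\<integral>\<omega>. f (\<lambda>n. real (nat \<bar>int_walk \<omega> n\<bar>)) \<partial>M)"
  proof (rule integral_cong_AE)
    show "(\<lambda>\<omega>. f (\<lambda>n. \<bar>walk X n \<omega>\<bar>)) \<in> borel_measurable M"
      using measurable_abs_walk by (rule measurable_compose) fact
    show "(\<lambda>\<omega>. f (\<lambda>n. real (nat \<bar>int_walk \<omega> n\<bar>))) \<in> borel_measurable M"
      using V by (rule measurable_compose) (rule F)
    show "AE \<omega> in M. f (\<lambda>n. \<bar>walk X n \<omega>\<bar>) = f (\<lambda>n. real (nat \<bar>int_walk \<omega> n\<bar>))"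
      using AE_walk_eq_int_walk by eventually_elim simp
  qed
  also have "\<dots> = (\<integral>z. f (\<lambda>n. real (z n)) \<partial>distr M ?P (\<lambda>\<omega> n. nat \<bar>int_walk \<omega> n\<bar>))"
    by (rule integral_distr[OF V F, symmetric])
  also have "\<dots> = (\<integral>u. f (\<lambda>n. real (run (abs_step p) 0 u n)) \<partial>uniform_seq)"
    unfolding distr_abs_walk by (rule integral_distr[OF Z F])
  finally show ?thesis .
qed

end

section \<open>Comparison of the expectations\<close>

lemma integrable_bounded_run:
  fixes f :: "(nat \<Rightarrow> real) \<Rightarrow> real"
  assumes "f \<in> borel_measurable borel" and "bounded (range f)"
  shows "integrable uniform_seq (\<lambda>u. f (\<lambda>n. real (run (abs_step p) 0 u n)))"
proof -
  interpret prob_space uniform_seq by (rule prob_space_uniform_seq)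
  obtain B where B: "\<And>x. norm (f x) \<le> B"
    using assms(2) by (auto simp: bounded_iff)
  have "(\<lambda>u. real (run (abs_step p) 0 u n)) \<in> borel_measurable uniform_seq" for n
    by (rule measurable_compose[OF measurable_run[OF measurable_abs_step]]) auto
  then have "(\<lambda>u n. real (run (abs_step p) 0 u n)) \<in> borel_measurable uniform_seq"
    by (rule measurable_coordinatewise_then_product)
  then have "(\<lambda>u. f (\<lambda>n. real (run (abs_step p) 0 u n))) \<in> borel_measurable uniform_seq"
    by (rule measurable_compose) fact
  with B show ?thesis by (intro integrable_const_bound[where B = B]) auto
qed

theorem theorem1:
  fixes p' p'' :: real
    and M :: "'a measure" and X :: "nat \<Rightarrow> 'a \<Rightarrow> real"
    and N :: "'b measure" and Y :: "nat \<Rightarrow> 'b \<Rightarrow> real"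
  assumes "p' \<in> {0..1}" and "p'' \<in> {0..1}"
    and "\<bar>p' - 1 / 2\<bar> > \<bar>p'' - 1 / 2\<bar>"
    and "bernoulli_steps M p' X"
    and "bernoulli_steps N p'' Y"
  shows "stoch_le N (\<lambda>\<omega> n. \<bar>walk Y n \<omega>\<bar>) M (\<lambda>\<omega> n. \<bar>walk X n \<omega>\<bar>)"
proof -
  interpret X: bernoulli_steps M p' X by fact
  interpret Y: bernoulli_steps N p'' Y by fact
  have up: "up_prob p'' k \<le> up_prob p' k" for k
    using assms by (intro up_prob_mono_dist) auto
  have "(\<integral>\<omega>. f (\<lambda>n. \<bar>walk Y n \<omega>\<bar>) \<partial>N) \<le> (\<integral>\<omega>. f (\<lambda>n. \<bar>walk X n \<omega>\<bar>) \<partial>M)"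
    if f: "f \<in> borel_measurable borel" "bounded (range f)" "mono f"
    for f :: "(nat \<Rightarrow> real) \<Rightarrow> real"
    unfolding X.integral_abs_walk[OF f(1)] Y.integral_abs_walk[OF f(1)]
    by (intro integral_mono integrable_bounded_run f monoD[OF f(3)])
       (auto simp: le_fun_def run_abs_step_mono[OF up])
  then show ?thesis
    unfolding stoch_le_def
    using X.prob_space_axioms Y.prob_space_axioms X.measurable_abs_walk Y.measurable_abs_walk
    by blast
qed

end
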